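(* If $(u,S,\mathbf{E},\mathbf{H})$ is a solution of the field equations $$\square u+W'(u)+\left[|\nabla S-q\mathbf{A}|^2-\left(\tfrac{\partial S}{\partial t}+q\varphi\right)^2\right]u=0,$$ $$\frac{\partial}{\partial t}\left[\left(\tfrac{\partial S}{\partial t}+q\varphi\right)u^2\right]-\nabla\cdot\left[(\nabla S-q\mathbf{A})u^2\right]=0,$$ $$\nabla\cdot\left(\tfrac{\partial \mathbf{A}}{\partial t}+\nabla\varphi\right)=q\left(\tfrac{\partial S}{\partial t}+q\varphi\right)u^2,$$ $$\nabla\times(\nabla\times\mathbf{A})+\frac{\partial}{\partial t}\left(\tfrac{\partial \mathbf{A}}{\partial t}+\nabla\varphi\right)=q(\nabla S-q\mathbf{A})u^2,$$ where $$\mathbf{E}=-\left(\frac{\partial\mathbf{A}}{\partial t}+\nabla\varphi\right),\quad \mathbf{H}=\nabla\times\mathbf{A},\quad \rho=-\left(\frac{\partial S}{\partial t}+q\varphi\right)qu^2,\quad \mathbf{j}=(\nabla S-q\mathbf{A})qu^2,$$ then its energy is given by $$\mathcal{E}(u,S,\mathbf{E},\mathbf{H})=\int_{\mathbb{R}^3}\left[\frac12\left(\frac{\partial u}{\partial t}\right)^2+\frac12|\nabla u|^2+W(u)+\frac{\rho^2+\mathbf{j}^2}{2q^2u^2}+\frac{\mathbf{E}^2+\mathbf{H}^2}{2}\right]dx .$$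
   Context: Here $q>0$ is a real parameter. The matter field $\psi=u\,e^{iS}$ is a complex-valued function of $(x,t)\in\mathbb{R}^3\times\mathbb{R}$ written in polar form, with $u(x,t)\ge 0$ and $S(x,t)\in\mathbb{R}/2\pi\mathbb{Z}$; $\varphi$ (real valued) and $\mathbf{A}$ ($\mathbb{R}^3$-valued) are the gauge potentials. The function $W:\mathbb{C}\to\mathbb{R}$ satisfies $W(e^{i\vartheta}\psi)=W(\psi)$, so it depends only on $|\psi|=u$. The operator $\square$ is $\frac{\partial^2}{\partial t^2}-\Delta$, and $\nabla$, $\nabla\cdot$, $\nabla\times$, $\Delta$ are the gradient, divergence, curl and Laplacian in $x\in\mathbb{R}^3$; $\mathbf{j}^2=|\mathbf{j}|^2$, and similarly for $\mathbf{E}^2$, $\mathbf{H}^2$. The field equations are the Euler-Lagrange equations of the action $\int\int\mathcal{L}\,dx\,dt$ with Lagrangian density $$\mathcal{L}=\frac12\left(\frac{\partial u}{\partial t}\right)^2-\frac12|\nabla u|^2-W(u)+\frac12\left[\left(\frac{\partial S}{\partial t}+q\varphi\right)^2-|\nabla S-q\mathbf{A}|^2\right]u^2+\frac12\left(\left|\frac{\partial\mathbf{A}}{\partial t}+\nabla\varphi\right|^2-|\nabla\times\mathbf{A}|^2\right).$$ The energy of a solution is the integral over $\mathbb{R}^3$ of the energy density $$\frac{\partial\mathcal{L}}{\partial(\partial_t u)}\,\partial_t u+\frac{\partial\mathcal{L}}{\partial(\partial_t S)}\,\partial_t S+\frac{\partial\mathcal{L}}{\partial(\partial_t\varphi)}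\,\partial_t\varphi+\frac{\partial\mathcal{L}}{\partial(\partial_t\mathbf{A})}\cdot\partial_t\mathbf{A}-\mathcal{L}.$$
   Formalization: Added: |x|²|φ||E| → 0 as |x| → ∞ at the given time, and both energy densities are integrable; ψ, φ, A are C². Without decay the claim fails: φ → φ+c, S → S−qct shifts the canonical energy by c times the total charge. *)

theory Defs
  imports "HOL-Analysis.Analysis"
begin

definition C2 :: "('a::real_normed_vector \<Rightarrow> 'b::real_normed_vector) \<Rightarrow> bool" where
  "C2 f \<longleftrightarrow> (\<exists>(f' :: 'a \<Rightarrow> 'a \<Rightarrow>\<^sub>L 'b) (f'' :: 'a \<Rightarrow> 'a \<Rightarrow>\<^sub>L ('a \<Rightarrow>\<^sub>L 'b)).
     (\<forall>z. (f has_derivative blinfun_apply (f' z)) (at z)) \<and>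
     (\<forall>z. (f' has_derivative blinfun_apply (f'' z)) (at z)) \<and>
     continuous_on UNIV f'')"

definition dt :: "(real^3 \<Rightarrow> real \<Rightarrow> 'a::real_normed_vector) \<Rightarrow> real^3 \<Rightarrow> real \<Rightarrow> 'a" where
  "dt f x t = vector_derivative (\<lambda>s. f x s) (at t)"

definition dx :: "3 \<Rightarrow> (real^3 \<Rightarrow> real \<Rightarrow> 'a::real_normed_vector) \<Rightarrow> real^3 \<Rightarrow> real \<Rightarrow> 'a" where
  "dx i f x t = vector_derivative (\<lambda>h. f (x + h *\<^sub>R axis i 1) t) (at 0)"

definition grad :: "(real^3 \<Rightarrow> real \<Rightarrow> real) \<Rightarrow> real^3 \<Rightarrow> real \<Rightarrow> real^3" where
  "grad f x t = (\<chi> i. dx i f x t)"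

definition divergence :: "(real^3 \<Rightarrow> real \<Rightarrow> real^3) \<Rightarrow> real^3 \<Rightarrow> real \<Rightarrow> real" where
  "divergence F x t = (\<Sum>i\<in>UNIV. dx i (\<lambda>y s. F y s $ i) x t)"

definition curl :: "(real^3 \<Rightarrow> real \<Rightarrow> real^3) \<Rightarrow> real^3 \<Rightarrow> real \<Rightarrow> real^3" where
  "curl F x t = vector
     [dx 2 (\<lambda>y s. F y s $ 3) x t - dx 3 (\<lambda>y s. F y s $ 2) x t,
      dx 3 (\<lambda>y s. F y s $ 1) x t - dx 1 (\<lambda>y s. F y s $ 3) x t,
      dx 1 (\<lambda>y s. F y s $ 2) x t - dx 2 (\<lambda>y s. F y s $ 1) x t]"

definition laplacian :: "(real^3 \<Rightarrow> real \<Rightarrow> real) \<Rightarrow> real^3 \<Rightarrow> real \<Rightarrow> real" where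
  "laplacian f = divergence (grad f)"

definition box_op :: "(real^3 \<Rightarrow> real \<Rightarrow> real) \<Rightarrow> real^3 \<Rightarrow> real \<Rightarrow> real" where
  "box_op f x t = dt (dt f) x t - laplacian f x t"


text \<open>
  The phase takes values in the reals modulo \<open>2\<pi>\<close>. It is represented by an arbitrary,
  possibly discontinuous, real-valued choice \<open>S\<close> of representatives; only \<open>exp (i S)\<close>
  carries information. Its derivatives are \<open>\<partial>S = Im (exp (- i S) \<partial> exp (i S))\<close>,
  i.e. the derivatives of any differentiable local lift of the phase.
\<close>

definition matter_field ::
  "(real^3 \<Rightarrow> real \<Rightarrow> real) \<Rightarrow> (real^3 \<Rightarrow> real \<Rightarrow> real) \<Rightarrow> real^3 \<Rightarrow> real \<Rightarrow> complex" where
  "matter_field u S x t = complex_of_real (u x t) * cis (S x t)"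

definition phase_dt :: "(real^3 \<Rightarrow> real \<Rightarrow> real) \<Rightarrow> real^3 \<Rightarrow> real \<Rightarrow> real" where
  "phase_dt S x t = Im (cnj (cis (S x t)) * dt (\<lambda>y s. cis (S y s)) x t)"

definition phase_grad :: "(real^3 \<Rightarrow> real \<Rightarrow> real) \<Rightarrow> real^3 \<Rightarrow> real \<Rightarrow> real^3" where
  "phase_grad S x t = (\<chi> i. Im (cnj (cis (S x t)) * dx i (\<lambda>y s. cis (S y s)) x t))"

lemma Im_cis_vector_derivative:
  assumes "(g has_vector_derivative d) (at a)"
  shows "Im (cnj (cis (g a)) * vector_derivative (\<lambda>s. cis (g s)) (at a)) = d"
proof -
  have "((\<lambda>s. cis (g s)) has_vector_derivative (d *\<^sub>R (\<i> * cis (g a)))) (at a)"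
  proof -
    have "(cis has_vector_derivative (\<i> * cis (g a))) (at (g a))"
      unfolding cis_conv_exp
      by (auto intro!: derivative_eq_intros has_vector_derivative_real_field)
    from vector_diff_chain_at[OF assms this] show ?thesis by (simp add: o_def)
  qed
  then have "vector_derivative (\<lambda>s. cis (g s)) (at a) = d *\<^sub>R (\<i> * cis (g a))"
    by (rule vector_derivative_at)
  moreover have "cnj (cis (g a)) * (d *\<^sub>R (\<i> * cis (g a))) = d *\<^sub>R \<i>"
    by (simp add: cis_cnj cis_mult algebra_simps)
  ultimately show ?thesis by simp
qed

lemma phase_dt_eq_dt:
  assumes "(\<lambda>s. S x s) differentiable (at t)"
  shows "phase_dt S x t = dt S x t"
  using Im_cis_vector_derivative[of "\<lambda>s. S x s" "vector_derivative (\<lambda>s. S x s) (at t)" t] assms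
  by (simp add: phase_dt_def dt_def vector_derivative_works)

lemma phase_grad_eq_grad:
  assumes "\<And>i. (\<lambda>h. S (x + h *\<^sub>R axis i 1) t) differentiable (at 0)"
  shows "phase_grad S x t = grad S x t"
proof -
  have "Im (cnj (cis (S x t)) * dx i (\<lambda>y s. cis (S y s)) x t) = dx i S x t" for i
    using Im_cis_vector_derivative[of "\<lambda>h. S (x + h *\<^sub>R axis i 1) t"
        "vector_derivative (\<lambda>h. S (x + h *\<^sub>R axis i 1) t) (at 0)" 0] assms[of i]
    by (simp add: dx_def vector_derivative_works)
  then show ?thesis by (simp add: phase_grad_def grad_def)
qed


text \<open>
  The Lagrangian density is a function of the values and first derivatives of the fields,
  which are treated as independent variables in the derivatives \<open>\<partial>L/\<partial>(\<partial>\<^sub>t u)\<close> etc.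
\<close>

record jet =
  j_u :: real
  j_ut :: real
  j_ux :: "real^3"
  j_St :: real
  j_Sx :: "real^3"
  j_phi :: real
  j_phit :: real
  j_phix :: "real^3"
  j_A :: "real^3"
  j_At :: "real^3"
  j_curlA :: "real^3"

definition lagrangian :: "(complex \<Rightarrow> real) \<Rightarrow> real \<Rightarrow> jet \<Rightarrow> real" where
  "lagrangian W q J =
     1/2 * (j_ut J)\<^sup>2 - 1/2 * (norm (j_ux J))\<^sup>2 - W (complex_of_real (j_u J))
     + 1/2 * ((j_St J + q * j_phi J)\<^sup>2 - (norm (j_Sx J - q *\<^sub>R j_A J))\<^sup>2) * (j_u J)\<^sup>2
     + 1/2 * ((norm (j_At J + j_phix J))\<^sup>2 - (norm (j_curlA J))\<^sup>2)"

definition jet_of ::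
  "(real^3 \<Rightarrow> real \<Rightarrow> real) \<Rightarrow> (real^3 \<Rightarrow> real \<Rightarrow> real) \<Rightarrow> (real^3 \<Rightarrow> real \<Rightarrow> real) \<Rightarrow>
   (real^3 \<Rightarrow> real \<Rightarrow> real^3) \<Rightarrow> real^3 \<Rightarrow> real \<Rightarrow> jet" where
  "jet_of u S \<phi> A x t =
     \<lparr>j_u = u x t, j_ut = dt u x t, j_ux = grad u x t,
      j_St = phase_dt S x t, j_Sx = phase_grad S x t,
      j_phi = \<phi> x t, j_phit = dt \<phi> x t, j_phix = grad \<phi> x t,
      j_A = A x t, j_At = dt A x t, j_curlA = curl A x t\<rparr>"

definition jet_energy_density :: "(complex \<Rightarrow> real) \<Rightarrow> real \<Rightarrow> jet \<Rightarrow> real" where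
  "jet_energy_density W q J =
     deriv (\<lambda>v. lagrangian W q (J\<lparr>j_ut := v\<rparr>)) (j_ut J) * j_ut J
     + deriv (\<lambda>v. lagrangian W q (J\<lparr>j_St := v\<rparr>)) (j_St J) * j_St J
     + deriv (\<lambda>v. lagrangian W q (J\<lparr>j_phit := v\<rparr>)) (j_phit J) * j_phit J
     + (\<chi> i. deriv (\<lambda>h. lagrangian W q (J\<lparr>j_At := j_At J + h *\<^sub>R axis i 1\<rparr>)) 0) \<bullet> j_At J
     - lagrangian W q J"

definition energy_density where
  "energy_density W q u S \<phi> A x t = jet_energy_density W q (jet_of u S \<phi> A x t)"

definition energy where
  "energy W q u S \<phi> A t = (\<integral>x. energy_density W q u S \<phi> A x t \<partial>lborel)"


definition E_field ::
  "(real^3 \<Rightarrow> real \<Rightarrow> real) \<Rightarrow> (real^3 \<Rightarrow> real \<Rightarrow> real^3) \<Rightarrow> real^3 \<Rightarrow> real \<Rightarrow> real^3" where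
  "E_field \<phi> A x t = - (dt A x t + grad \<phi> x t)"

definition H_field :: "(real^3 \<Rightarrow> real \<Rightarrow> real^3) \<Rightarrow> real^3 \<Rightarrow> real \<Rightarrow> real^3" where
  "H_field A x t = curl A x t"

definition charge_density where
  "charge_density q u S \<phi> x t = - (phase_dt S x t + q * \<phi> x t) * q * (u x t)\<^sup>2"

definition current_density where
  "current_density q u S A x t = (q * (u x t)\<^sup>2) *\<^sub>R (phase_grad S x t - q *\<^sub>R A x t)"

text \<open>
  Where \<open>u = 0\<close>, both \<open>\<rho>\<close> and \<open>j\<close> vanish and the quotient below is \<open>0 / 0 = 0\<close>, which is
  the value of \<open>((\<partial>\<^sub>t S + q \<phi>)\<^sup>2 + |\<nabla>S - q A|\<^sup>2) u\<^sup>2 / 2\<close> there.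
  By the Gauss equation, this density differs from the one above by the divergence of \<open>\<phi> E\<close>;
  the two integrals agree only if \<open>\<phi> E\<close> has no flux at infinity (a gauge condition on \<open>\<phi>\<close>).
\<close>

definition gauge_invariant_energy_density where
  "gauge_invariant_energy_density W q u S \<phi> A x t =
     1/2 * (dt u x t)\<^sup>2 + 1/2 * (norm (grad u x t))\<^sup>2 + W (complex_of_real (u x t))
     + ((charge_density q u S \<phi> x t)\<^sup>2 + (norm (current_density q u S A x t))\<^sup>2)
         / (2 * q\<^sup>2 * (u x t)\<^sup>2)
     + ((norm (E_field \<phi> A x t))\<^sup>2 + (norm (H_field A x t))\<^sup>2) / 2"


text \<open>
  Only the matter field, not its modulus and phase separately, is required to be \<open>C\<^sup>2\<close>:
  at zeros of the matter field (e.g. on a vortex line) \<open>u\<close> need not be differentiable and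
  the phase is undefined. Hence the first equation is imposed where \<open>u > 0\<close>. In the others
  the derivatives of the phase occur only multiplied by \<open>u\<^sup>2\<close>, and they hold everywhere.
\<close>

definition solution ::
  "(complex \<Rightarrow> real) \<Rightarrow> real \<Rightarrow> (real^3 \<Rightarrow> real \<Rightarrow> real) \<Rightarrow> (real^3 \<Rightarrow> real \<Rightarrow> real) \<Rightarrow>
   (real^3 \<Rightarrow> real \<Rightarrow> real) \<Rightarrow> (real^3 \<Rightarrow> real \<Rightarrow> real^3) \<Rightarrow> bool" where
  "solution W q u S \<phi> A \<longleftrightarrow>
     (\<forall>x t. u x t \<ge> 0) \<and>
     C2 (\<lambda>(x, t). matter_field u S x t) \<and> C2 (\<lambda>(x, t). \<phi> x t) \<and> C2 (\<lambda>(x, t). A x t) \<and>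
     (\<forall>x t. u x t > 0 \<longrightarrow>
        box_op u x t + deriv (\<lambda>r. W (complex_of_real r)) (u x t)
        + ((norm (phase_grad S x t - q *\<^sub>R A x t))\<^sup>2 - (phase_dt S x t + q * \<phi> x t)\<^sup>2) * u x t = 0) \<and>
     (\<forall>x t. dt (\<lambda>y s. (phase_dt S y s + q * \<phi> y s) * (u y s)\<^sup>2) x t
        - divergence (\<lambda>y s. (u y s)\<^sup>2 *\<^sub>R (phase_grad S y s - q *\<^sub>R A y s)) x t = 0) \<and>
     (\<forall>x t. divergence (\<lambda>y s. dt A y s + grad \<phi> y s) x t
        = q * (phase_dt S x t + q * \<phi> x t) * (u x t)\<^sup>2) \<and>
     (\<forall>x t. curl (curl A) x t + dt (\<lambda>y s. dt A y s + grad \<phi> y s) x t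
        = (q * (u x t)\<^sup>2) *\<^sub>R (phase_grad S x t - q *\<^sub>R A x t))"

end

theory Submission
  imports Defs
begin

text \<open>
  Computing the partial derivatives of the Lagrangian and completing squares, the energy density
  equals the density on the right-hand side minus \<open>\<phi> (q (\<partial>\<^sub>t S + q \<phi>) u\<^sup>2) + G \<bullet> \<nabla>\<phi>\<close>
  with \<open>G = \<partial>\<^sub>t A + \<nabla>\<phi> = - E\<close>. By the Gauss equation the subtracted term is the divergence of
  \<open>\<phi> G\<close>, a continuously differentiable field which is \<open>o(|x|\<^sup>-\<^sup>2)\<close> and has integrable divergence;
  such a divergence integrates to zero. The latter is shown without surface integrals: multiply
  by a cutoff, use that directional derivatives of compactly supported functions integrate to
  zero by translation invariance of Lebesgue measure, and remove the cutoff.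
\<close>

subsection \<open>Integrals of divergences\<close>

lemma integrable_continuous_bounded_support:
  fixes f :: "'a::euclidean_space \<Rightarrow> real"
  assumes "continuous_on UNIV f" and "\<And>x. norm x > R \<Longrightarrow> f x = 0"
  shows "integrable lborel f"
proof -
  have "integrable lborel (\<lambda>x. indicator (cball 0 R) x *\<^sub>R f x)"
    using assms(1) by (intro borel_integrable_compact) (auto intro: continuous_on_subset)
  moreover have "(\<lambda>x. indicator (cball 0 R) x *\<^sub>R f x) = f"
    using assms(2) by (fastforce simp: indicator_def)
  ultimately show ?thesis by simp
qed

lemma lborel_integral_translate:
  fixes f :: "'a::euclidean_space \<Rightarrow> real"
  assumes "f \<in> borel_measurable borel"
  shows "(\<integral>x. f (c + x) \<partial>lborel) = (\<integral>x. f x \<partial>lborel)"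
proof -
  have "(\<integral>x. f x \<partial>lborel) = (\<integral>x. f x \<partial>distr lborel borel ((+) c))"
    by (simp add: lborel_distr_plus)
  also have "\<dots> = (\<integral>x. f (c + x) \<partial>lborel)"
    using assms by (intro integral_distr) auto
  finally show ?thesis by simp
qed

text \<open>By translation invariance every difference quotient of \<open>g\<close> along
  \<open>v\<close> has integral zero. The quotients converge pointwise to the derivative under a
  common integrable bound, so dominated convergence carries the zero to the limit.\<close>

lemma directional_derivative_bounded_support:
  fixes g :: "'a::euclidean_space \<Rightarrow> real"
  assumes deriv: "\<And>x. (g has_derivative g' x) (at x)"
    and cont: "continuous_on UNIV (\<lambda>x. g' x v)"
    and supp: "\<And>x. norm x > R \<Longrightarrow> g x = 0"
  shows integrable_directional_derivative: "integrable lborel (\<lambda>x. g' x v)"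
    and integral_directional_derivative: "(\<integral>x. g' x v \<partial>lborel) = 0"
proof -
  define s where "s n x = (g (inverse (real (Suc n)) *\<^sub>R v + x) - g x) * real (Suc n)" for n x
  have cg: "continuous_on UNIV g"
    by (intro continuous_at_imp_continuous_on ballI has_derivative_continuous[OF deriv])
  have gi: "integrable lborel g"
    by (rule integrable_continuous_bounded_support[OF cg supp])
  have gm [measurable]: "g \<in> borel_measurable borel"
    using cg by (rule borel_measurable_continuous_onI)
  have line: "((\<lambda>r. g (x + r *\<^sub>R v)) has_real_derivative g' (x + r *\<^sub>R v) v) (at r)" for x r
  proof -
    have "((\<lambda>r. g (x + r *\<^sub>R v)) has_derivative (\<lambda>h. g' (x + r *\<^sub>R v) (h *\<^sub>R v))) (at r)"
      by (rule has_derivative_compose[OF _ deriv]) (auto intro!: derivative_eq_intros)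
    moreover have "(\<lambda>h. g' (x + r *\<^sub>R v) (h *\<^sub>R v)) = (*) (g' (x + r *\<^sub>R v) v)"
      using linear_scale[OF has_derivative_linear[OF deriv]] by auto
    ultimately show ?thesis by (simp add: has_field_derivative_def)
  qed
  \<comment> \<open>The mean value theorem will evaluate the derivative at
    \<open>x + z *\<^sub>R v\<close> with \<open>norm x \<le> R + norm v\<close> and
    \<open>z < 1\<close>, hence the radius \<open>R + 2 * norm v\<close>.\<close>
  have "compact (cball 0 (R + 2 * norm v) :: 'a set)" by simp
  then have "bounded ((\<lambda>x. g' x v) ` cball 0 (R + 2 * norm v))"
    by (intro compact_imp_bounded compact_continuous_image continuous_on_subset[OF cont]) auto
  then obtain B where B: "\<And>x. norm x \<le> R + 2 * norm v \<Longrightarrow> \<bar>g' x v\<bar> \<le> B"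
    by (fastforce simp: bounded_iff)
  have bound: "norm (s n x) \<le> B * indicator (cball 0 (R + norm v)) x" for n x
  proof -
    define r where "r = inverse (real (Suc n))"
    have r: "0 < r" "r \<le> 1" by (auto simp: r_def field_simps)
    have rv: "norm (c *\<^sub>R v) \<le> norm v" if "0 \<le> c" "c \<le> r" for c
      using that r by (simp add: mult_left_le_one_le)
    obtain z where z: "0 < z" "z < r" "g (x + r *\<^sub>R v) - g x = r * g' (x + z *\<^sub>R v) v"
      using MVT2[of 0 r "\<lambda>r. g (x + r *\<^sub>R v)" "\<lambda>r. g' (x + r *\<^sub>R v) v"] line r by auto
    have s: "s n x = g' (x + z *\<^sub>R v) v"
      using z r(1) by (simp add: s_def r_def field_simps del: of_nat_Suc)
    show ?thesis
    proof (cases "norm x \<le> R + norm v")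
      case True
      have "norm (x + z *\<^sub>R v) \<le> R + 2 * norm v"
        using norm_triangle_ineq[of x "z *\<^sub>R v"] rv[of z] z True by linarith
      with True s B show ?thesis by simp
    next
      \<comment> \<open>Here neither \<open>x\<close> nor its translate, moved by at most
        \<open>norm v\<close>, reaches the support of \<open>g\<close>.\<close>
      case False
      have "norm (r *\<^sub>R v + x) > R"
        using norm_triangle_ineq[of "r *\<^sub>R v + x" "- (r *\<^sub>R v)"] rv[of r] r False by simp
      moreover have "norm x > R" using False norm_ge_zero[of v] by linarith
      ultimately have "s n x = 0" using supp by (simp add: s_def r_def)
      with False show ?thesis by simp
    qed
  qed
  have lim: "(\<lambda>n. s n x) \<longlonglongrightarrow> g' x v" for x
  proof -
    have "((\<lambda>h. (g (x + h *\<^sub>R v) - g x) / h) \<longlongrightarrow> g' x v) (at 0)"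
      using line[of x 0] by (simp add: has_field_derivative_iff)
    moreover have "filterlim (\<lambda>n. inverse (real (Suc n))) (at 0) sequentially"
      by (intro filterlim_atI LIMSEQ_inverse_real_of_nat) auto
    ultimately have "(\<lambda>n. (g (x + inverse (real (Suc n)) *\<^sub>R v) - g x) / inverse (real (Suc n))) \<longlonglongrightarrow> g' x v"
      by (rule filterlim_compose)
    then show ?thesis by (simp add: s_def divide_inverse add.commute)
  qed
  have int0: "(\<integral>x. s n x \<partial>lborel) = 0" for n
  proof -
    have "integrable lborel (\<lambda>x. g (inverse (real (Suc n)) *\<^sub>R v + x))"
    proof (rule integrable_continuous_bounded_support[where R = "R + norm (inverse (real (Suc n)) *\<^sub>R v)"])
      show "continuous_on UNIV (\<lambda>x. g (inverse (real (Suc n)) *\<^sub>R v + x))"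
        by (intro continuous_on_compose2[OF cg] continuous_intros) auto
      fix x :: 'a
      let ?w = "inverse (real (Suc n)) *\<^sub>R v"
      assume "norm x > R + norm ?w"
      then have "norm (?w + x) > R"
        using norm_triangle_ineq[of "?w + x" "- ?w"] unfolding norm_minus_cancel by simp
      then show "g (?w + x) = 0" by (rule supp)
    qed
    with gi show ?thesis
      by (simp add: s_def lborel_integral_translate del: of_nat_Suc)
  qed
  have m: "(\<lambda>x. g' x v) \<in> borel_measurable lborel"
    using borel_measurable_continuous_onI[OF cont] by simp
  have sm: "s n \<in> borel_measurable lborel" for n
    unfolding s_def[abs_def] by measurable
  have w: "integrable lborel (\<lambda>x::'a. B * indicator (cball 0 (R + norm v)) x)"
    by (intro integrable_mult_right integrable_real_indicator) (use emeasure_bounded_finite[OF bounded_cball] in auto)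
  show "integrable lborel (\<lambda>x. g' x v)"
    by (rule integrable_dominated_convergence[where s = s, OF m sm w]) (use lim bound in auto)
  have "(\<lambda>n. \<integral>x. s n x \<partial>lborel) \<longlonglongrightarrow> (\<integral>x. g' x v \<partial>lborel)"
    by (rule integral_dominated_convergence[where s = s, OF m sm w]) (use lim bound in auto)
  then show "(\<integral>x. g' x v \<partial>lborel) = 0"
    by (simp add: int0 LIMSEQ_const_iff)
qed

section \<open>A continuously differentiable cutoff function\<close>

text \<open>Squaring removes the kink of the positive part: at 0 the difference quotient is bounded
  by \<open>\<bar>h\<bar>\<close>. This is what makes \<open>cutoff\<close> differentiable across
  the sphere of radius \<open>R\<close>, with continuous gradient.\<close>

lemma has_real_derivative_max_0_power2:
  "((\<lambda>r::real. (max 0 r)\<^sup>2) has_real_derivative 2 * max 0 r) (at r)"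
proof (cases "r = 0")
  case True
  have "((\<lambda>h. (max 0 h)\<^sup>2 / h) \<longlongrightarrow> (0::real)) (at 0)"
  proof (rule Lim_null_comparison)
    show "\<forall>\<^sub>F h in at 0. norm ((max 0 h)\<^sup>2 / h) \<le> \<bar>h::real\<bar>"
      by (intro always_eventually) (auto simp: max_def power2_eq_square)
    show "((\<lambda>h. \<bar>h\<bar>) \<longlongrightarrow> (0::real)) (at 0)"
      by (auto intro!: tendsto_eq_intros)
  qed
  with True show ?thesis by (simp add: has_field_derivative_iff)
next
  case False
  then consider "r > 0" | "r < 0" by linarith
  then show ?thesis
  proof cases
    case 1
    have "((\<lambda>r::real. r\<^sup>2) has_real_derivative 2 * max 0 r) (at r)"
      using 1 by (auto intro!: derivative_eq_intros)
    moreover have "open {0::real<..}" "r \<in> {0<..}" using 1 by auto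
    ultimately show ?thesis
      by (rule has_field_derivative_transform_within_open) auto
  next
    case 2
    have "((\<lambda>r::real. 0) has_real_derivative 2 * max 0 r) (at r)"
      using 2 by (auto intro!: derivative_eq_intros)
    moreover have "open {..<0::real}" "r \<in> {..<0}" using 2 by auto
    ultimately show ?thesis
      by (rule has_field_derivative_transform_within_open) auto
  qed
qed

text \<open>
  The power \<open>DIM('a)\<close> makes the gradient small near the origin, where the decay hypothesis on a
  field \<open>F\<close> gives nothing: it bounds \<open>\<nabla>(cutoff R) \<bullet> F\<close> by \<open>o(R\<^sup>-\<^sup>n)\<close> uniformly on the ball of
  radius \<open>R\<close>, whose volume is \<open>O(R\<^sup>n)\<close>.
\<close>

definition cutoff :: "real \<Rightarrow> 'a::euclidean_space \<Rightarrow> real" where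
  "cutoff R x = (max 0 (1 - (x \<bullet> x / R\<^sup>2) ^ DIM('a)))\<^sup>2"

definition cutoff_deriv :: "real \<Rightarrow> 'a::euclidean_space \<Rightarrow> 'a \<Rightarrow> real" where
  "cutoff_deriv R x h = - (4 * real DIM('a) * max 0 (1 - (x \<bullet> x / R\<^sup>2) ^ DIM('a))
     * (x \<bullet> x / R\<^sup>2) ^ (DIM('a) - 1) * (x \<bullet> h / R\<^sup>2))"

lemma cutoff_has_derivative:
  fixes x :: "'a::euclidean_space"
  shows "(cutoff R has_derivative cutoff_deriv R x) (at x)"
proof -
  let ?n = "DIM('a)"
  have "((\<lambda>x::'a. x \<bullet> x / R\<^sup>2) has_derivative (\<lambda>h. 2 * (x \<bullet> h) / R\<^sup>2)) (at x)"
    unfolding divide_inverse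
    by (auto intro!: derivative_eq_intros simp: inner_commute)
  from has_derivative_diff[OF has_derivative_const has_derivative_power[OF this]]
  have 1: "((\<lambda>x::'a. 1 - (x \<bullet> x / R\<^sup>2) ^ ?n) has_derivative
      (\<lambda>h. - (real ?n * (x \<bullet> x / R\<^sup>2) ^ (?n - 1) * (2 * (x \<bullet> h) / R\<^sup>2)))) (at x)"
    by (rule has_derivative_eq_rhs) (simp add: mult_ac)
  have 2: "((\<lambda>r::real. (max 0 r)\<^sup>2) has_derivative (*) (2 * max 0 r)) (at r)" for r
    using has_real_derivative_max_0_power2 by (simp add: has_field_derivative_def)
  from has_derivative_compose[OF 1 2] show ?thesis
    unfolding cutoff_def[abs_def] cutoff_deriv_def[abs_def]
    by (rule has_derivative_eq_rhs) (auto simp: fun_eq_iff)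
qed

lemma cutoff_nonneg: "0 \<le> cutoff R x"
  by (simp add: cutoff_def)

lemma cutoff_le_1: "cutoff R x \<le> 1"
  by (auto simp: cutoff_def max_def power_le_one_iff)

lemma cutoff_bounded_support:
  fixes x :: "'a::euclidean_space"
  assumes "R > 0" "norm x \<ge> R"
  shows "cutoff R x = 0" "cutoff_deriv R x h = 0"
proof -
  have "R\<^sup>2 \<le> x \<bullet> x" using assms by (simp add: dot_square_norm power_mono)
  then have "1 \<le> x \<bullet> x / R\<^sup>2" using assms(1) by simp
  then have "max 0 (1 - (x \<bullet> x / R\<^sup>2) ^ DIM('a)) = 0" using one_le_power[of "x \<bullet> x / R\<^sup>2"] by simp
  then show "cutoff R x = 0" "cutoff_deriv R x h = 0"
    by (simp_all only: cutoff_def cutoff_deriv_def) simp_all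
qed

lemma cutoff_tendsto_1: "(\<lambda>k. cutoff (real (Suc k)) (x :: 'a::euclidean_space)) \<longlonglongrightarrow> 1"
proof -
  have "(\<lambda>k. inverse (real (Suc k))) \<longlonglongrightarrow> 0" by (rule LIMSEQ_inverse_real_of_nat)
  then have "(\<lambda>k. (max 0 (1 - (x \<bullet> x * (inverse (real (Suc k)))\<^sup>2) ^ DIM('a)))\<^sup>2) \<longlonglongrightarrow>
      (max 0 (1 - (x \<bullet> x * 0\<^sup>2) ^ DIM('a)))\<^sup>2"
    by (intro tendsto_intros)
  then show ?thesis
    by (simp add: cutoff_def divide_inverse power_inverse power_0_left del: of_nat_Suc)
qed

text \<open>The last factor is arranged to become, for \<open>h = F x\<close>, the weight
  \<open>norm x ^ (DIM('a) - 1) * norm (F x)\<close> that is assumed to decay. Inside the ball the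
  remaining \<open>norm x / R ^ (DIM('a) + 1)\<close> is at most the inverse of
  \<open>R ^ DIM('a)\<close>.\<close>

lemma abs_cutoff_deriv_le:
  fixes x h :: "'a::euclidean_space"
  assumes "R > 0"
  shows "\<bar>cutoff_deriv R x h\<bar> \<le>
    4 * real DIM('a) * norm x / R ^ (DIM('a) + 1) * (norm x ^ (DIM('a) - 1) * norm h)"
proof (cases "norm x < R")
  case True
  obtain m where m: "DIM('a) = Suc m"
    using DIM_positive[where 'a='a] gr0_implies_Suc by blast
  let ?r = "norm x / R"
  have r: "0 \<le> ?r" "?r \<le> 1" using True assms by auto
  have q: "x \<bullet> x / R\<^sup>2 = ?r\<^sup>2" by (simp add: dot_square_norm power_divide)
  have "\<bar>x \<bullet> h / R\<^sup>2\<bar> \<le> ?r * (norm h / R)"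
    using Cauchy_Schwarz_ineq2[of x h] assms by (simp add: power2_eq_square divide_right_mono)
  moreover have "\<bar>max 0 (1 - (?r\<^sup>2) ^ Suc m)\<bar> \<le> 1" by auto
  \<comment> \<open>Of the \<open>2 * m\<close> factors \<open>?r\<close> only \<open>m\<close> are
    kept, since \<open>?r \<le> 1\<close>; they supply exactly the power of \<open>norm x\<close> in
    the weight.\<close>
  moreover have "\<bar>(?r\<^sup>2) ^ m\<bar> \<le> ?r ^ m"
    using r power_decreasing[of m "2 * m" ?r] by (simp add: power_mult[symmetric])
  ultimately have "\<bar>max 0 (1 - (?r\<^sup>2) ^ Suc m)\<bar> * \<bar>(?r\<^sup>2) ^ m\<bar> * \<bar>x \<bullet> h / R\<^sup>2\<bar>
      \<le> 1 * ?r ^ m * (?r * (norm h / R))"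
    using r by (intro mult_mono) auto
  then have le: "(4 * real (Suc m)) * (\<bar>max 0 (1 - (?r\<^sup>2) ^ Suc m)\<bar> * \<bar>(?r\<^sup>2) ^ m\<bar> * \<bar>x \<bullet> h / R\<^sup>2\<bar>)
      \<le> (4 * real (Suc m)) * (1 * ?r ^ m * (?r * (norm h / R)))"
    by (intro mult_left_mono) auto
  have "\<bar>cutoff_deriv R x h\<bar> =
      (4 * real (Suc m)) * (\<bar>max 0 (1 - (?r\<^sup>2) ^ Suc m)\<bar> * \<bar>(?r\<^sup>2) ^ m\<bar> * \<bar>x \<bullet> h / R\<^sup>2\<bar>)"
    unfolding cutoff_deriv_def m q by (simp add: abs_mult del: power_Suc of_nat_Suc)
  also note le
  also have "(4 * real (Suc m)) * (1 * ?r ^ m * (?r * (norm h / R))) =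
      4 * real (Suc m) * norm x / R ^ (Suc m + 1) * (norm x ^ m * norm h)"
    using assms by (simp add: power_divide mult_ac del: of_nat_Suc)
  finally show ?thesis by (simp add: m)
next
  case False
  then have "cutoff_deriv R x h = 0" using cutoff_bounded_support(2)[of R x] assms by simp
  then show ?thesis using assms by (auto intro!: mult_nonneg_nonneg divide_nonneg_nonneg)
qed

section \<open>A divergence theorem on the whole space without boundary term\<close>

text \<open>Integration by parts against \<open>cutoff R\<close> turns the integral of
  \<open>cutoff R x * D x\<close> into minus that of \<open>cutoff_deriv R x (F x)\<close>. As
  \<open>R\<close> grows the first tends to the integral of the divergence, because \<open>D\<close>
  is integrable, and the second is eventually below any positive bound, because of the
  decay.\<close>

lemma integral_divergence_eq_0:
  fixes F :: "'a::euclidean_space \<Rightarrow> 'a"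
  assumes deriv: "\<And>x. (F has_derivative F' x) (at x)"
    and cont: "\<And>b. b \<in> Basis \<Longrightarrow> continuous_on UNIV (\<lambda>x. F' x b \<bullet> b)"
    and decay: "((\<lambda>x. norm x ^ (DIM('a) - 1) * norm (F x)) \<longlongrightarrow> 0) at_infinity"
    and int: "integrable lborel (\<lambda>x. \<Sum>b\<in>Basis. F' x b \<bullet> b)"
  shows "(\<integral>x. (\<Sum>b\<in>Basis. F' x b \<bullet> b) \<partial>lborel) = 0"
proof -
  let ?n = "DIM('a)"
  define D where "D x = (\<Sum>b\<in>Basis. F' x b \<bullet> b)" for x
  define V where "V = measure lborel (cball (0::'a) 1)"
  have cF: "continuous_on UNIV F"
    by (intro continuous_at_imp_continuous_on ballI has_derivative_continuous[OF deriv])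
  \<comment> \<open>A general field \<open>G\<close> covers both uses: a constant basis vector and
    \<open>F\<close> itself.\<close>
  have cont_cd: "continuous_on UNIV (\<lambda>x. cutoff_deriv R x (G x))"
    if "continuous_on UNIV G" for R and G :: "'a \<Rightarrow> 'a"
    unfolding cutoff_deriv_def divide_inverse by (intro continuous_intros that)
  have cont_c: "continuous_on UNIV (cutoff R :: 'a \<Rightarrow> real)" for R
    by (intro continuous_at_imp_continuous_on ballI has_derivative_continuous[OF cutoff_has_derivative])
  have iD: "integrable lborel D" using int by (simp add: D_def[abs_def])
  have parts: "(\<integral>x. cutoff R x * D x \<partial>lborel) = - (\<integral>x. cutoff_deriv R x (F x) \<partial>lborel)"
    and icd: "integrable lborel (\<lambda>x. cutoff_deriv R x (F x))" if R: "R > 0" for R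
  proof -
    \<comment> \<open>\<open>P b x\<close> is the product rule derivative of the
      \<open>b\<close>-component of \<open>cutoff R x *\<^sub>R F x\<close>; summing
      \<open>P b x b\<close> over the basis gives the divergence of the cut-off field.\<close>
    define P where "P b x h = cutoff R x * (F' x h \<bullet> b) + cutoff_deriv R x h * (F x \<bullet> b)" for b x h
    have P: "((\<lambda>x. cutoff R x * (F x \<bullet> b)) has_derivative P b x) (at x)" for b x
      unfolding P_def
      by (intro has_derivative_mult cutoff_has_derivative has_derivative_inner_left deriv)
    have cP: "continuous_on UNIV (\<lambda>x. P b x b)" if "b \<in> Basis" for b
      unfolding P_def by (intro continuous_intros cont_c cont_cd cont[OF that] cF)
    have z: "cutoff R x * (F x \<bullet> b) = 0" if "norm x > R" for x b
      using cutoff_bounded_support(1)[OF R, of x] that by simp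
    have Pi: "integrable lborel (\<lambda>x. P b x b)" "(\<integral>x. P b x b \<partial>lborel) = 0" if "b \<in> Basis" for b
      using directional_derivative_bounded_support[OF P cP[OF that] z] by auto
    have lin: "(\<Sum>b\<in>Basis. cutoff_deriv R x b * (F x \<bullet> b)) = cutoff_deriv R x (F x)" for x
    proof -
      have "cutoff_deriv R x (\<Sum>b\<in>Basis. (F x \<bullet> b) *\<^sub>R b) = (\<Sum>b\<in>Basis. (F x \<bullet> b) *\<^sub>R cutoff_deriv R x b)"
        by (simp only: linear_sum[OF has_derivative_linear[OF cutoff_has_derivative]]
            linear_scale[OF has_derivative_linear[OF cutoff_has_derivative]])
      then show ?thesis by (simp add: euclidean_representation mult.commute)
    qed
    have sum: "(\<Sum>b\<in>Basis. P b x b) = cutoff R x * D x + cutoff_deriv R x (F x)" for x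
      by (simp add: P_def D_def sum.distrib sum_distrib_left lin)
    show icd: "integrable lborel (\<lambda>x. cutoff_deriv R x (F x))"
      by (intro integrable_continuous_bounded_support[where R=R] cont_cd cF
          cutoff_bounded_support(2)[OF R] less_imp_le)
    have "(\<integral>x. (\<Sum>b\<in>Basis. P b x b) \<partial>lborel) = 0"
      using Pi by simp
    then have 0: "(\<integral>x. cutoff R x * D x + cutoff_deriv R x (F x) \<partial>lborel) = 0"
      by (simp add: sum)
    have "integrable lborel (\<lambda>x. \<Sum>b\<in>Basis. P b x b)" using Pi by simp
    then have "integrable lborel (\<lambda>x. cutoff R x * D x + cutoff_deriv R x (F x))"
      by (simp add: sum)
    from Bochner_Integration.integrable_diff[OF this icd]
    have "integrable lborel (\<lambda>x. cutoff R x * D x)" by simp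
    from 0 Bochner_Integration.integral_add[OF this icd]
    show "(\<integral>x. cutoff R x * D x \<partial>lborel) = - (\<integral>x. cutoff_deriv R x (F x) \<partial>lborel)"
      by simp
  qed
  have lim: "(\<lambda>k. \<integral>x. cutoff (real (Suc k)) x * D x \<partial>lborel) \<longlonglongrightarrow> (\<integral>x. D x \<partial>lborel)"
  proof (rule integral_dominated_convergence[where w = "\<lambda>x. \<bar>D x\<bar>"])
    show "D \<in> borel_measurable lborel" using iD by (rule borel_measurable_integrable)
    then show "(\<lambda>x. cutoff (real (Suc k)) x * D x) \<in> borel_measurable lborel" for k
      using borel_measurable_continuous_onI[OF cont_c] by auto
    show "integrable lborel (\<lambda>x. \<bar>D x\<bar>)" using iD by simp
    show "AE x in lborel. (\<lambda>k. cutoff (real (Suc k)) x * D x) \<longlonglongrightarrow> D x"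
      using tendsto_mult[OF cutoff_tendsto_1 tendsto_const] by (intro AE_I2) fastforce
    show "AE x in lborel. norm (cutoff (real (Suc k)) x * D x) \<le> \<bar>D x\<bar>" for k
      by (intro AE_I2) (simp add: abs_mult cutoff_nonneg cutoff_le_1 mult_left_le_one_le del: of_nat_Suc)
  qed
  have small: "\<bar>\<integral>x. D x \<partial>lborel\<bar> \<le> 4 * real ?n * V * e" if e: "e > 0" for e
  proof -
    define w where "w x = norm x ^ (?n - 1) * norm (F x)" for x
    have "\<forall>\<^sub>F x in at_infinity. w x < e"
      using order_tendstoD(2)[OF decay e] by (simp add: w_def)
    then obtain M where M: "\<And>x. norm x \<ge> M \<Longrightarrow> w x < e"
      by (auto simp: eventually_at_infinity)
    have w0: "0 \<le> w x" for x by (simp add: w_def)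
    \<comment> \<open>The decay says nothing on \<open>cball 0 M\<close>. There
      \<open>norm x * w x\<close> is bounded by a constant \<open>K\<close> independent of
      \<open>R\<close>, and \<open>K \<le> e * R\<close> once \<open>R\<close> is large.\<close>
    have "bounded ((\<lambda>x. norm x * w x) ` cball 0 M)"
      unfolding w_def
      by (intro compact_imp_bounded compact_continuous_image continuous_intros
          continuous_on_subset[OF cF]) auto
    then obtain K where "\<And>y. y \<in> (\<lambda>x. norm x * w x) ` cball 0 M \<Longrightarrow> norm y \<le> K"
      unfolding bounded_iff by blast
    from this[OF imageI] have K: "norm x * w x \<le> K" if "norm x \<le> M" for x
      using that by (simp add: abs_mult w0)
    have "\<forall>\<^sub>F k in sequentially. K \<le> e * real (Suc k)"
    proof -
      obtain N where N: "K / e \<le> real N" using real_arch_simple by blast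
      have "K \<le> e * real (Suc k)" if "k \<ge> N" for k
        using N that e by (simp add: field_simps)
          (smt (verit) mult_left_mono of_nat_le_iff mult.commute)
      then show ?thesis by (auto simp: eventually_sequentially)
    qed
    then have "\<forall>\<^sub>F k in sequentially. \<bar>\<integral>x. cutoff (real (Suc k)) x * D x \<partial>lborel\<bar> \<le> 4 * real ?n * V * e"
    proof eventually_elim
      case (elim k)
      define R where "R = real (Suc k)"
      have R: "R > 0" "K \<le> e * R" using elim by (auto simp: R_def)
      \<comment> \<open>Inside radius \<open>R\<close>, \<open>norm x * w x \<le> e * R\<close>
        holds in both regions: up to \<open>M\<close> through \<open>K\<close>, beyond
        \<open>M\<close> through \<open>w x < e\<close> and \<open>norm x < R\<close>.\<close>
      have pt: "\<bar>cutoff_deriv R x (F x)\<bar> \<le> 4 * real ?n * e / R ^ ?n * indicator (cball 0 R) x" for x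
      proof (cases "norm x < R")
        case True
        have "norm x * w x \<le> e * R"
        proof (cases "norm x \<le> M")
          case False
          then have "norm x * w x \<le> R * e"
            using M[of x] True w0[of x] R(1) by (intro mult_mono) auto
          then show ?thesis by (simp add: mult.commute)
        qed (use K R in fastforce)
        then have "(4 * real ?n / R ^ (?n + 1)) * (norm x * w x) \<le> (4 * real ?n / R ^ (?n + 1)) * (e * R)"
          using R by (intro mult_left_mono) auto
        also have "\<dots> = 4 * real ?n * e / R ^ ?n" using R by simp
        finally show ?thesis
          using abs_cutoff_deriv_le[OF R(1), of x "F x"] True by (simp add: w_def mult.assoc)
      next
        case False
        then show ?thesis using cutoff_bounded_support(2)[OF R(1), of x] R e by simp
      qed
      have ib: "integrable lborel (\<lambda>x::'a. 4 * real ?n * e / R ^ ?n * indicator (cball 0 R) x)"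
        by (intro integrable_mult_right integrable_real_indicator) (use emeasure_bounded_finite[OF bounded_cball] in auto)
      have "\<bar>\<integral>x. cutoff_deriv R x (F x) \<partial>lborel\<bar> \<le>
          (\<integral>x. 4 * real ?n * e / R ^ ?n * indicator (cball 0 R) (x::'a) \<partial>lborel)"
        using Bochner_Integration.integral_norm_bound_integral[OF icd[OF R(1)] ib] pt by simp
      also have "\<dots> = 4 * real ?n * e / R ^ ?n * measure lborel (cball (0::'a) R)"
        by simp
      \<comment> \<open>The volume of the ball scales with \<open>R ^ ?n\<close> and cancels the
        denominator, so the bound does not depend on \<open>R\<close>.\<close>
      also have "\<dots> = 4 * real ?n * V * e"
        using R by (simp add: V_def content_cball)
      finally show ?case using parts[OF R(1)] by (simp add: R_def)
    qed
    then show ?thesis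
      by (intro tendsto_upperbound[OF tendsto_rabs[OF lim]]) auto
  qed
  have V: "V \<ge> 0" by (simp add: V_def)
  have "\<bar>\<integral>x. D x \<partial>lborel\<bar> \<le> 0"
  proof (rule field_le_epsilon)
    fix d :: real assume d: "d > 0"
    let ?c = "4 * real ?n * V"
    have c: "?c \<ge> 0" using V by simp
    \<comment> \<open>The added 1 keeps the denominator positive, as only \<open>?c \<ge> 0\<close>
      is at hand.\<close>
    have "\<bar>\<integral>x. D x \<partial>lborel\<bar> \<le> ?c * (d / (?c + 1))"
      using d c by (intro small divide_pos_pos add_nonneg_pos) auto
    also have "\<dots> \<le> d" using d c by (simp add: field_simps)
    finally show "\<bar>\<integral>x. D x \<partial>lborel\<bar> \<le> 0 + d" by simp
  qed
  then show ?thesis by (simp add: D_def)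
qed

subsection \<open>Regularity of time slices\<close>

text \<open>Continuity of the derivative is asked for one direction \<open>h\<close> at a time. This
  suffices for the continuity hypothesis of \<open>integral_divergence_eq_0\<close> and avoids
  bundling derivatives as bounded linear functions.\<close>

definition C1 :: "('a::real_normed_vector \<Rightarrow> 'b::real_normed_vector) \<Rightarrow> bool" where
  "C1 f \<longleftrightarrow> (\<exists>D. (\<forall>x. (f has_derivative D x) (at x)) \<and> (\<forall>h. continuous_on UNIV (\<lambda>x. D x h)))"

lemma C1_imp_continuous_on: "C1 f \<Longrightarrow> continuous_on UNIV f"
  unfolding C1_def by (meson continuous_at_imp_continuous_on has_derivative_continuous)

lemma C1_const: "C1 (\<lambda>x. c)"
  unfolding C1_def by (rule exI[of _ "\<lambda>x h. 0"]) auto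

lemma C1_add:
  assumes "C1 f" "C1 g"
  shows "C1 (\<lambda>x. f x + g x)"
proof -
  obtain D where D: "\<And>x. (f has_derivative D x) (at x)" "\<And>h. continuous_on UNIV (\<lambda>x. D x h)"
    using assms(1) by (auto simp: C1_def)
  obtain E where E: "\<And>x. (g has_derivative E x) (at x)" "\<And>h. continuous_on UNIV (\<lambda>x. E x h)"
    using assms(2) by (auto simp: C1_def)
  have "((\<lambda>x. f x + g x) has_derivative (\<lambda>h. D x h + E x h)) (at x)" for x
    using D(1) E(1) by (rule has_derivative_add)
  moreover have "continuous_on UNIV (\<lambda>x. D x h + E x h)" for h
    by (intro continuous_intros D E)
  ultimately show ?thesis unfolding C1_def by (intro exI[of _ "\<lambda>x h. D x h + E x h"]) blast
qed

lemma C1_sum: "(\<And>i. i \<in> I \<Longrightarrow> C1 (f i)) \<Longrightarrow> C1 (\<lambda>x. \<Sum>i\<in>I. f i x)"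
  by (induction I rule: infinite_finite_induct) (auto intro: C1_add C1_const)

lemma C1_scaleR_const:
  assumes "C1 f"
  shows "C1 (\<lambda>x. f x *\<^sub>R c)"
proof -
  obtain D where D: "\<And>x. (f has_derivative D x) (at x)" "\<And>h. continuous_on UNIV (\<lambda>x. D x h)"
    using assms by (auto simp: C1_def)
  have "((\<lambda>x. f x *\<^sub>R c) has_derivative (\<lambda>h. D x h *\<^sub>R c)) (at x)" for x
    using D(1) by (rule has_derivative_scaleR_left)
  moreover have "continuous_on UNIV (\<lambda>x. D x h *\<^sub>R c)" for h
    by (intro continuous_intros D)
  ultimately show ?thesis unfolding C1_def by (intro exI[of _ "\<lambda>x h. D x h *\<^sub>R c"]) blast
qed

text \<open>Time and coordinate derivatives are values of the total derivative \<open>f'\<close> at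
  the fixed vectors \<open>(0, 1)\<close> and \<open>(axis i 1, 0)\<close>. Hence one statement
  about \<open>f' (x, t) v\<close> for fixed \<open>v\<close>, whose derivative comes from
  \<open>f''\<close>, serves both.\<close>

lemma C2_slice:
  fixes f :: "real^3 \<Rightarrow> real \<Rightarrow> 'b::real_normed_vector"
  assumes "C2 (\<lambda>(x, t). f x t)"
  shows C2_slice_C1: "C1 (\<lambda>x. f x t)"
    and C2_dt_C1: "C1 (\<lambda>x. dt f x t)"
    and C2_dx_C1: "C1 (\<lambda>x. dx i f x t)"
proof -
  obtain f' :: "(real^3) \<times> real \<Rightarrow> ((real^3) \<times> real) \<Rightarrow>\<^sub>L 'b" and f''
    where f': "\<And>z. ((\<lambda>(x, t). f x t) has_derivative blinfun_apply (f' z)) (at z)"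
      and f'': "\<And>z. (f' has_derivative blinfun_apply (f'' z)) (at z)"
      and cf'': "continuous_on UNIV f''"
    using assms unfolding C2_def by blast
  have pair: "((\<lambda>x. (x, t)) has_derivative (\<lambda>h. (h, 0))) (at x)" for x :: "real^3"
    by (auto intro!: derivative_eq_intros)
  have slice: "((\<lambda>x. f x t) has_derivative (\<lambda>h. f' (x, t) (h, 0))) (at x)" for x
    using has_derivative_compose[OF pair f'] by simp
  have slice': "C1 (\<lambda>x. f' (x, t) v)" for v
  proof -
    have "((\<lambda>x. f' (x, t)) has_derivative (\<lambda>h. f'' (x, t) (h, 0))) (at x)" for x
      using has_derivative_compose[OF pair f''] by simp
    then have "((\<lambda>x. f' (x, t) v) has_derivative (\<lambda>h. f'' (x, t) (h, 0) v)) (at x)" for x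
      by (rule bounded_linear.has_derivative[OF blinfun.bounded_linear_left])
    moreover have "continuous_on UNIV (\<lambda>x. f'' (x, t) (h, 0) v)" for h
      by (intro continuous_intros continuous_on_compose2[OF cf'']) auto
    ultimately show ?thesis
      unfolding C1_def by (intro exI[of _ "\<lambda>x h. f'' (x, t) (h, 0) v"]) blast
  qed
  show "C1 (\<lambda>x. f x t)"
    unfolding C1_def using slice C1_imp_continuous_on[OF slice']
    by (intro exI[of _ "\<lambda>x h. f' (x, t) (h, 0)"]) blast
  have "dt f x t = f' (x, t) (0, 1)" for x
  proof -
    have "((\<lambda>s. (x, s)) has_derivative (\<lambda>h. (0, h))) (at t)"
      by (auto intro!: derivative_eq_intros)
    from has_derivative_compose[OF this f']
    have "(f x has_derivative (\<lambda>h. f' (x, t) (0, h))) (at t)" by simp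
    moreover have "(\<lambda>h. f' (x, t) (0, h)) = (\<lambda>h. h *\<^sub>R f' (x, t) (0, 1))"
      by (simp add: fun_eq_iff flip: blinfun.scaleR_right)
    ultimately have "(f x has_vector_derivative f' (x, t) (0, 1)) (at t)"
      by (simp only: has_vector_derivative_def)
    then show ?thesis by (simp add: dt_def vector_derivative_at)
  qed
  then show "C1 (\<lambda>x. dt f x t)" using slice' by simp
  have "dx i f x t = f' (x, t) (axis i 1, 0)" for x
  proof -
    have "((\<lambda>h. (x + h *\<^sub>R axis i 1, t)) has_derivative (\<lambda>h. (h *\<^sub>R axis i 1, 0))) (at 0)"
      by (auto intro!: derivative_eq_intros)
    from has_derivative_compose[OF this f']
    have "((\<lambda>h. f (x + h *\<^sub>R axis i 1) t) has_derivative (\<lambda>h. f' (x, t) (h *\<^sub>R axis i 1, 0))) (at 0)"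
      by simp
    moreover have "f' (x, t) (h *\<^sub>R axis i 1, 0) = h *\<^sub>R f' (x, t) (axis i 1, 0)" for h
      by (simp flip: blinfun.scaleR_right)
    ultimately have "((\<lambda>h. f (x + h *\<^sub>R axis i 1) t) has_vector_derivative f' (x, t) (axis i 1, 0)) (at 0)"
      by (simp add: has_vector_derivative_def)
    then show ?thesis by (simp add: dx_def vector_derivative_at)
  qed
  then show "C1 (\<lambda>x. dx i f x t)" using slice' by simp
qed

section \<open>Coordinate expressions in terms of total derivatives\<close>

lemma dx_eq_has_derivative:
  assumes "((\<lambda>x. f x t) has_derivative D) (at x)"
  shows "dx i f x t = D (axis i 1)"
proof -
  have "((\<lambda>h. x + h *\<^sub>R axis i 1) has_derivative (\<lambda>h. h *\<^sub>R axis i 1)) (at 0)"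
    by (auto intro!: derivative_eq_intros)
  moreover have "((\<lambda>x. f x t) has_derivative D) (at (x + 0 *\<^sub>R axis i 1))" using assms by simp
  ultimately have "((\<lambda>h. f (x + h *\<^sub>R axis i 1) t) has_derivative (\<lambda>h. D (h *\<^sub>R axis i 1))) (at 0)"
    by (rule has_derivative_compose)
  moreover have "D (h *\<^sub>R axis i 1) = h *\<^sub>R D (axis i 1)" for h
    by (rule linear_scale[OF has_derivative_linear[OF assms]])
  ultimately show ?thesis
    by (simp add: dx_def has_vector_derivative_def vector_derivative_at)
qed

text \<open>Translates between the basis sums of the abstract divergence lemma and the coordinate
  sums in \<open>divergence\<close> and in the inner product.\<close>

lemma sum_Basis_vec:
  fixes f :: "real^'n \<Rightarrow> 'b::comm_monoid_add"
  shows "(\<Sum>b\<in>Basis. f b) = (\<Sum>i\<in>UNIV. f (axis i (1::real)))"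
proof -
  have "(Basis :: (real^'n) set) = range (\<lambda>i. axis i 1)" by (auto simp: Basis_vec_def)
  moreover have "inj (\<lambda>i. axis i 1 :: real^'n)" by (auto simp: inj_on_def axis_eq_axis)
  ultimately show ?thesis by (metis (no_types, lifting) sum.reindex_cong)
qed

lemma C1_grad:
  assumes "C2 (\<lambda>(x, t). f x t)"
  shows "C1 (\<lambda>x. grad f x t)"
proof -
  have "grad f x t = (\<Sum>i\<in>UNIV. dx i f x t *\<^sub>R axis i 1)" for x
    by (simp add: grad_def vec_eq_iff axis_def if_distrib[of "\<lambda>r. _ * r"] sum.delta' cong: if_cong)
  then show ?thesis
    by (simp only: C1_sum C1_scaleR_const C2_dx_C1[OF assms])
qed

subsection \<open>Energy densities\<close>

text \<open>The Lagrangian is quadratic in each of the time derivatives of \<open>u\<close>,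
  \<open>S\<close> and \<open>A\<close>, so the conjugate momenta are explicit. The time derivative
  of \<phi> does not occur in it, so its momentum is zero.\<close>

lemma jet_energy_density_eq:
  "jet_energy_density W q J = (j_ut J)\<^sup>2 + (j_St J + q * j_phi J) * (j_u J)\<^sup>2 * j_St J
     + (j_At J + j_phix J) \<bullet> j_At J - lagrangian W q J"
proof -
  have "deriv (\<lambda>v. lagrangian W q (J\<lparr>j_ut := v\<rparr>)) (j_ut J) = j_ut J"
  proof -
    \<comment> \<open>All terms free of \<open>v\<close>, \<open>W\<close> included, stay inside the
      constant \<open>lagrangian W q J\<close>; only a polynomial in \<open>v\<close> is
      differentiated. The other momenta are found in the same way.\<close>
    have eq: "lagrangian W q (J\<lparr>j_ut := v\<rparr>) = lagrangian W q J + (v\<^sup>2 - (j_ut J)\<^sup>2) / 2" for v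
      by (simp add: lagrangian_def field_simps)
    show ?thesis
      unfolding eq by (rule DERIV_imp_deriv) (auto intro!: derivative_eq_intros)
  qed
  moreover have "deriv (\<lambda>v. lagrangian W q (J\<lparr>j_St := v\<rparr>)) (j_St J) = (j_St J + q * j_phi J) * (j_u J)\<^sup>2"
  proof -
    have eq: "lagrangian W q (J\<lparr>j_St := v\<rparr>) = lagrangian W q J
        + ((v + q * j_phi J)\<^sup>2 - (j_St J + q * j_phi J)\<^sup>2) * (j_u J)\<^sup>2 / 2" for v
      by (simp add: lagrangian_def field_simps)
    show ?thesis
      unfolding eq by (rule DERIV_imp_deriv) (auto intro!: derivative_eq_intros)
  qed
  moreover have "deriv (\<lambda>v. lagrangian W q (J\<lparr>j_phit := v\<rparr>)) (j_phit J) = 0"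
    by (simp add: lagrangian_def)
  moreover have "deriv (\<lambda>h. lagrangian W q (J\<lparr>j_At := j_At J + h *\<^sub>R axis i 1\<rparr>)) 0 = (j_At J + j_phix J) $ i" for i
  proof -
    let ?G = "j_At J + j_phix J"
    have "(norm (j_At J + h *\<^sub>R axis i 1 + j_phix J))\<^sup>2 = ?G \<bullet> ?G + 2 * h * ?G $ i + h\<^sup>2" for h
      unfolding power2_norm_eq_inner
      by (simp add: inner_simps inner_commute[of "axis i 1"] inner_axis inner_axis_axis power2_eq_square algebra_simps)
    then have eq: "lagrangian W q (J\<lparr>j_At := j_At J + h *\<^sub>R axis i 1\<rparr>)
        = lagrangian W q J + (h * ?G $ i + h\<^sup>2 / 2)" for h
      by (simp add: lagrangian_def power2_norm_eq_inner[of ?G] field_simps)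
    show ?thesis
      unfolding eq by (rule DERIV_imp_deriv) (auto intro!: derivative_eq_intros)
  qed
  ultimately show ?thesis
    by (simp add: jet_energy_density_def power2_eq_square del: vector_add_component)
qed

text \<open>A pointwise identity that uses no field equation. With
  \<open>P = Om - q * \<phi>\<close> and \<open>dt A = G - grad \<phi>\<close>, the momentum terms
  become squares minus the two terms in \<phi> on the right.\<close>

lemma energy_density_diff:
  assumes "q \<noteq> 0"
  shows "energy_density W q u S \<phi> A x t - gauge_invariant_energy_density W q u S \<phi> A x t =
    - (\<phi> x t * (q * (phase_dt S x t + q * \<phi> x t) * (u x t)\<^sup>2) + (dt A x t + grad \<phi> x t) \<bullet> grad \<phi> x t)"
proof -
  define U where "U = (u x t)\<^sup>2"
  define G where "G = dt A x t + grad \<phi> x t"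
  define P where "P = phase_dt S x t"
  define Om where "Om = P + q * \<phi> x t"
  define B where "B = phase_grad S x t - q *\<^sub>R A x t"
  have e: "energy_density W q u S \<phi> A x t =
      1/2 * (dt u x t)\<^sup>2 + 1/2 * (norm (grad u x t))\<^sup>2 + W (complex_of_real (u x t)) + Om * U * P
      - (Om\<^sup>2 - (norm B)\<^sup>2) * U / 2 + G \<bullet> dt A x t - ((norm G)\<^sup>2 - (norm (curl A x t))\<^sup>2) / 2"
    unfolding energy_density_def jet_energy_density_eq lagrangian_def
    by (simp add: jet_of_def U_def G_def P_def Om_def B_def)
  have c: "charge_density q u S \<phi> x t = - (q * Om * U)" "current_density q u S A x t = (q * U) *\<^sub>R B"
    by (simp_all add: charge_density_def current_density_def U_def P_def Om_def B_def algebra_simps)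
  have "((- (q * Om * U))\<^sup>2 + (norm ((q * U) *\<^sub>R B))\<^sup>2) / (2 * q\<^sup>2 * U) = (Om\<^sup>2 + (norm B)\<^sup>2) * U / 2"
  \<comment> \<open>For \<open>U = 0\<close> the left side is 0 / 0, which evaluates to 0 and so
    agrees with the right side.\<close>
  proof (cases "U = 0")
    case False
    have "(- (q * Om * U))\<^sup>2 + (norm ((q * U) *\<^sub>R B))\<^sup>2 = (2 * q\<^sup>2 * U) * ((Om\<^sup>2 + (norm B)\<^sup>2) * U / 2)"
      by (simp add: power_mult_distrib power2_eq_square algebra_simps)
    then show ?thesis using False assms by simp
  qed simp
  then have g: "gauge_invariant_energy_density W q u S \<phi> A x t =
      1/2 * (dt u x t)\<^sup>2 + 1/2 * (norm (grad u x t))\<^sup>2 + W (complex_of_real (u x t))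
      + (Om\<^sup>2 + (norm B)\<^sup>2) * U / 2 + ((norm G)\<^sup>2 + (norm (curl A x t))\<^sup>2) / 2"
    unfolding gauge_invariant_energy_density_def c E_field_def H_field_def norm_minus_cancel
    by (simp only: U_def G_def)
  have "G \<bullet> dt A x t = (norm G)\<^sup>2 - G \<bullet> grad \<phi> x t"
    by (simp add: G_def power2_norm_eq_inner inner_simps)
  moreover have "Om * U * P = Om\<^sup>2 * U - \<phi> x t * (q * Om * U)"
    by (simp add: Om_def power2_eq_square algebra_simps)
  ultimately have "energy_density W q u S \<phi> A x t - gauge_invariant_energy_density W q u S \<phi> A x t =
      - (\<phi> x t * (q * Om * U) + G \<bullet> grad \<phi> x t)"
    unfolding e g by (simp add: field_simps)
  then show ?thesis by (simp add: U_def G_def P_def Om_def)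
qed

section \<open>Vanishing flux and equality of the two energies\<close>

text \<open>The rate in \<open>decay\<close> matches the growth of the area of spheres in three
  dimensions, so \<open>\<phi> E\<close> has no flux at infinity. The two integrability hypotheses
  together make the divergence of \<open>\<phi> E\<close> integrable.\<close>

theorem theorem1:
  fixes q t :: real
    and W :: "complex \<Rightarrow> real"
    and u S \<phi> :: "real^3 \<Rightarrow> real \<Rightarrow> real"
    and A :: "real^3 \<Rightarrow> real \<Rightarrow> real^3"
  assumes q_pos: "q > 0"
    and W_gauge: "\<And>\<theta> z. W (cis \<theta> * z) = W z"
    and W_diff: "\<And>r. r > 0 \<Longrightarrow> (\<lambda>r. W (complex_of_real r)) differentiable (at r)"
    and sol: "solution W q u S \<phi> A"
    and finite_energy: "integrable lborel (\<lambda>x. energy_density W q u S \<phi> A x t)"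
    and finite_rhs: "integrable lborel (\<lambda>x. gauge_invariant_energy_density W q u S \<phi> A x t)"
    and decay: "((\<lambda>x. (norm x)\<^sup>2 * (\<bar>\<phi> x t\<bar> * norm (E_field \<phi> A x t))) \<longlongrightarrow> 0) at_infinity"
  shows "energy W q u S \<phi> A t =
    (\<integral>x. (1/2 * (dt u x t)\<^sup>2 + 1/2 * (norm (grad u x t))\<^sup>2 + W (complex_of_real (u x t))
      + ((charge_density q u S \<phi> x t)\<^sup>2 + (norm (current_density q u S A x t))\<^sup>2)
          / (2 * q\<^sup>2 * (u x t)\<^sup>2)
      + ((norm (E_field \<phi> A x t))\<^sup>2 + (norm (H_field A x t))\<^sup>2) / 2) \<partial>lborel)"
proof -
  define G where "G x s = dt A x s + grad \<phi> x s" for x s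
  have C2: "C2 (\<lambda>(x, t). \<phi> x t)" "C2 (\<lambda>(x, t). A x t)"
    and gauss: "\<And>x. divergence G x t = q * (phase_dt S x t + q * \<phi> x t) * (u x t)\<^sup>2"
    using sol by (auto simp: solution_def G_def[abs_def])
  obtain D\<phi> where D\<phi>: "\<And>x. ((\<lambda>x. \<phi> x t) has_derivative D\<phi> x) (at x)"
    and cD\<phi>: "\<And>h. continuous_on UNIV (\<lambda>x. D\<phi> x h)"
    using C2_slice_C1[OF C2(1), of t] by (auto simp: C1_def)
  have "C1 (\<lambda>x. G x t)"
    unfolding G_def by (intro C1_add C2_dt_C1 C1_grad C2)
  then obtain DG where DG: "\<And>x. ((\<lambda>x. G x t) has_derivative DG x) (at x)"
    and cDG: "\<And>h. continuous_on UNIV (\<lambda>x. DG x h)"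
    and cG: "continuous_on UNIV (\<lambda>x. G x t)"
    using C1_imp_continuous_on by (auto simp: C1_def)
  \<comment> \<open>The derivative of \<open>\<phi> G\<close>; its trace is \<phi> times the
    divergence of \<open>G\<close> plus \<open>G \<bullet> grad \<phi>\<close>.\<close>
  define F' where "F' x h = \<phi> x t *\<^sub>R DG x h + D\<phi> x h *\<^sub>R G x t" for x h
  have F': "((\<lambda>x. \<phi> x t *\<^sub>R G x t) has_derivative F' x) (at x)" for x
    unfolding F'_def by (intro has_derivative_scaleR D\<phi> DG)
  have cF': "continuous_on UNIV (\<lambda>x. F' x b \<bullet> b)" for b
    unfolding F'_def
    by (intro continuous_intros cD\<phi> cDG cG C1_imp_continuous_on C2_slice_C1 C2)
  have "divergence G x t = (\<Sum>b\<in>Basis. DG x b \<bullet> b)" for x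
  proof -
    have "dx i (\<lambda>y s. G y s $ i) x t = DG x (axis i 1) $ i" for i
    proof (rule dx_eq_has_derivative)
      show "((\<lambda>x. G x t $ i) has_derivative (\<lambda>h. DG x h $ i)) (at x)"
        using DG by (rule bounded_linear.has_derivative[OF bounded_linear_vec_nth])
    qed
    then show ?thesis
      by (simp add: divergence_def sum_Basis_vec inner_axis)
  qed
  moreover have "G x t \<bullet> grad \<phi> x t = (\<Sum>b\<in>Basis. D\<phi> x b * (G x t \<bullet> b))" for x
  proof -
    have "grad \<phi> x t $ i = D\<phi> x (axis i 1)" for i
      by (simp add: grad_def dx_eq_has_derivative[where f = \<phi>, OF D\<phi>])
    then have "G x t \<bullet> grad \<phi> x t = (\<Sum>i\<in>UNIV. D\<phi> x (axis i 1) * G x t $ i)"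
      by (simp add: inner_vec_def mult.commute)
    then show ?thesis by (simp add: sum_Basis_vec inner_axis)
  qed
  \<comment> \<open>The Gauss equation enters here: it identifies the charge term of
    \<open>energy_density_diff\<close> with \<phi> times the divergence of \<open>G\<close>.\<close>
  ultimately have diff: "energy_density W q u S \<phi> A x t - gauge_invariant_energy_density W q u S \<phi> A x t =
      - (\<Sum>b\<in>Basis. F' x b \<bullet> b)" for x
    using energy_density_diff[of q W u S \<phi> A x t] q_pos gauss
    by (simp add: F'_def inner_simps sum.distrib sum_distrib_left flip: G_def)
  have "integrable lborel (\<lambda>x. - (\<Sum>b\<in>Basis. F' x b \<bullet> b))"
    using Bochner_Integration.integrable_diff[OF finite_energy finite_rhs] by (simp add: diff)
  from Bochner_Integration.integrable_minus[OF this]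
  have int: "integrable lborel (\<lambda>x. \<Sum>b\<in>Basis. F' x b \<bullet> b)" by simp
  have E: "norm (E_field \<phi> A x t) = norm (G x t)" for x
    by (simp only: E_field_def G_def norm_minus_cancel)
  \<comment> \<open>In dimension 3 the exponent is 2, which is the one in
    \<open>decay\<close>.\<close>
  have "((\<lambda>x. norm x ^ (DIM(real^3) - 1) * norm (\<phi> x t *\<^sub>R G x t)) \<longlongrightarrow> 0) at_infinity"
    using decay by (simp add: E)
  then have "(\<integral>x. (\<Sum>b\<in>Basis. F' x b \<bullet> b) \<partial>lborel) = 0"
    by (intro integral_divergence_eq_0[OF F' cF' _ int])
  then have "(\<integral>x. energy_density W q u S \<phi> A x t - gauge_invariant_energy_density W q u S \<phi> A x t \<partial>lborel) = 0"
    by (simp add: diff)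
  with Bochner_Integration.integral_diff[OF finite_energy finite_rhs] show ?thesis
    by (simp add: energy_def gauge_invariant_energy_density_def)
qed

end
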